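(* Let $L$ be a complete orthomodular lattice. There is a one-to-one correspondence between complete boolean subalgebras $M$ contained in the center $Z_F(L)$ of $L$ and endomorphisms $j:L\to L$ satisfying the Borceux-Van den Bossche conditions.
   Context: A complete orthomodular lattice is a complete lattice $L$ (least element $0$, greatest element $1$) with a unary operation $\perp:L\to L$ such that, for all $a,b,a_i\in L$ and any index set $I$: $a^{\perp\perp}=a$; $(\bigvee_{i\in I}a_i)^\perp=\bigwedge_{i\in I}a_i^\perp$; $a\vee a^\perp=1$; $a\wedge a^\perp=0$; and if $a\le b$ then $b=a\vee(a^\perp\wedge b)$. For $a,b\in L$ put $a\,\&^F b=(a\vee b^\perp)\wedge b$. The center of $L$ is $Z_F(L)=\{a\in L\mid a\,\&^F b=b\,\&^F a=a\wedge b \text{ for all } b\in L\}$; it is a boolean subalgebra of $L$. A complete boolean subalgebra of $L$ is a subset of $L$ that is closed under arbitrary joins and meets (computed in $L$, including the empty ones) and under $\perp$, and that is a boolean algebra under the inherited operations. "Endomorphism" of $L$ here means a map $j:L\to L$ (not required to be a lattice homomorphism). It satisfies the Borceux-Van den Bossche conditions if it is a closure operation (order preserving, $a\le j(a)$, $j(j(a))=j(a)$) and, for all $a,b,a_i,b_i\in L$ and every index set $I$ (possibly empty): 1. $a\le j(a)$; 2. $j(a\wedge j(b))=j(a)\wedge j(b)$; 3. $a\wedge j(\bigvee_{i\in I}b_i)=\bigvee_{i\in I}(a\wedge j(b_i))$; 4. $(\bigvee_{i\in I}a_i)\wedge j(b)=\bigvee_{i\in I}(a_i\wedge j(b))$.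 *)

theory Defs
  imports "HOL-Library.Complemented_Lattices"
begin

(* The class complete_orthomodular_lattice writes the orthocomplement as unary minus and asks
   only that it be an antitone involution; the De Morgan law for arbitrary joins follows. *)

lemma uminus_Sup_eq_INF:
  fixes A :: "'a::complete_orthomodular_lattice set"
  shows "- Sup A = (INF a\<in>A. - a)"
proof (rule antisym)
  show "- Sup A \<le> (INF a\<in>A. - a)"
    by (rule INF_greatest) (simp add: Sup_upper)
  have "Sup A \<le> - (INF a\<in>A. - a)"
  proof (rule Sup_least)
    fix a assume "a \<in> A"
    then have "(INF a\<in>A. - a) \<le> - a" by (rule INF_lower)
    then show "a \<le> - (INF a\<in>A. - a)" by (rule compl_le_swap1)
  qed
  then show "(INF a\<in>A. - a) \<le> - Sup A" by (rule compl_le_swap1)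
qed

definition foulis_prod :: "'a::complete_orthomodular_lattice \<Rightarrow> 'a \<Rightarrow> 'a"
  where "foulis_prod a b = inf (sup a (- b)) b"

definition oml_center :: "'a::complete_orthomodular_lattice set"
  where "oml_center = {a. \<forall>b. foulis_prod a b = inf a b \<and> foulis_prod b a = inf a b}"

(* Closure under Sup and Inf includes Sup {} = bot and Inf {} = top, so such an M is a bounded
   sublattice; it is then a boolean algebra iff it is distributive and uminus complements it. *)

definition complete_boolean_subalgebra :: "'a::complete_orthomodular_lattice set \<Rightarrow> bool"
  where "complete_boolean_subalgebra M \<longleftrightarrow>
    (\<forall>A. A \<subseteq> M \<longrightarrow> Sup A \<in> M) \<and>
    (\<forall>A. A \<subseteq> M \<longrightarrow> Inf A \<in> M) \<and>
    (\<forall>x\<in>M. - x \<in> M) \<and>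
    (\<forall>x\<in>M. \<forall>y\<in>M. \<forall>z\<in>M. inf x (sup y z) = sup (inf x y) (inf x z)) \<and>
    (\<forall>x\<in>M. \<forall>y\<in>M. \<forall>z\<in>M. sup x (inf y z) = inf (sup x y) (sup x z)) \<and>
    (\<forall>x\<in>M. inf x (- x) = bot \<and> sup x (- x) = top)"

definition closure_operation :: "('a::order \<Rightarrow> 'a) \<Rightarrow> bool"
  where "closure_operation j \<longleftrightarrow> mono j \<and> (\<forall>a. a \<le> j a) \<and> (\<forall>a. j (j a) = j a)"

(* Joins of families are given as joins of subsets B: a family enters these laws only through
   its range, and the empty family is B = {}. *)

definition borceux_van_den_bossche :: "('a::complete_orthomodular_lattice \<Rightarrow> 'a) \<Rightarrow> bool"
  where "borceux_van_den_bossche j \<longleftrightarrow>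
    closure_operation j \<and>
    (\<forall>a. a \<le> j a) \<and>
    (\<forall>a b. j (inf a (j b)) = inf (j a) (j b)) \<and>
    (\<forall>a B. inf a (j (Sup B)) = (SUP b\<in>B. inf a (j b))) \<and>
    (\<forall>A b. inf (Sup A) (j b) = (SUP a\<in>A. inf a (j b)))"

end

theory Submission
  imports Defs
begin

text \<open>
  A complete boolean subalgebra \<open>M\<close> is sent to the operation mapping \<open>a\<close> to the least element of
  \<open>M\<close> above \<open>a\<close>, and a closure operation \<open>j\<close> to its set of fixed points. For arbitrary closure
  operations and arbitrary subsets closed under meets these two assignments are mutually inverse,
  so what has to be shown is that the Borceux-Van den Bossche conditions on \<open>j\<close> say exactly that
  the fixed points form a complete boolean subalgebra of central elements.

  From \<open>M\<close> to \<open>j\<close>: a central element commutes with everything, so it behaves like an element of a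
  boolean algebra as far as residuation is concerned: \<open>a \<sqinter> c \<le> s\<close> implies \<open>a \<le> s \<squnion> - c\<close>. This
  gives the distributivity of meets over joins when the \<open>j\<close>-closed side is central
  (\<open>inf_Sup_central\<close> and \<open>Sup_inf_central\<close>), which are the third and fourth conditions once it
  is known that \<open>j\<close> preserves joins. For the second condition one uses in addition that
  \<open>M\<close> contains the complements \<open>- c\<close>.

  From \<open>j\<close> to \<open>M\<close>: the fourth condition distributes \<open>(b \<squnion> - m) \<sqinter> m\<close> for a fixed point \<open>m\<close>, which
  says that \<open>m\<close> splits along every \<open>b\<close>, and this is all that centrality requires. The second
  condition, applied to \<open>- m\<close> and \<open>m\<close>, shows that \<open>j (- m)\<close> is disjoint from \<open>m\<close>, whence \<open>- m\<close>
  is again a fixed point by centrality.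
\<close>

section \<open>Commutation and the center\<close>

lemma orthomodular_cut:
  fixes s b :: "'a::orthomodular_lattice"
  assumes "s \<le> b"
  shows "inf (sup s (- b)) b = s"
proof -
  have "sup (- b) (inf (- (- b)) (- s)) = - s"
    using assms by (intro orthomodular) simp
  then have "- sup (- b) (inf (- (- b)) (- s)) = s" by simp
  then show ?thesis by (simp add: ac_simps)
qed

text \<open>
  In the orthomodular decomposition of \<open>b\<close> along \<open>inf c b\<close>, the second summand is
  \<open>inf (sup (- c) (- b)) b\<close>; the hypothesis, complemented, rewrites \<open>sup (- c) (- b)\<close> so that this
  summand becomes \<open>inf (- c) b\<close>.
\<close>
lemma split_if_foulis_prod_eq_inf:
  fixes b c :: "'a::complete_orthomodular_lattice"
  assumes "foulis_prod c b = inf c b"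
  shows "b = sup (inf c b) (inf (- c) b)"
proof -
  have "- inf (sup c (- b)) b = - inf c b"
    using assms by (simp add: foulis_prod_def)
  then have eq: "sup (inf (- c) b) (- b) = sup (- c) (- b)" by simp
  have "b = sup (inf c b) (inf (- inf c b) b)"
    by (rule orthomodular[symmetric]) simp
  also have "inf (- inf c b) b = inf (sup (inf (- c) b) (- b)) b"
    by (simp add: eq)
  also have "\<dots> = inf (- c) b"
    by (rule orthomodular_cut) simp
  finally show ?thesis .
qed

lemma foulis_prod_eq_inf_if_split:
  fixes b c :: "'a::complete_orthomodular_lattice"
  assumes "c = sup (inf c b) (inf c (- b))"
  shows "foulis_prod c b = inf c b"
proof -
  have "sup c (- b) = sup (inf c b) (sup (inf c (- b)) (- b))"
    using assms by (metis sup_assoc)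
  also have "\<dots> = sup (inf c b) (- b)"
    by (simp add: sup_absorb2)
  finally show ?thesis
    by (simp add: foulis_prod_def orthomodular_cut)
qed

text \<open>
  Commutation is symmetric, so of the two identities defining the center the one
  in which \<open>c\<close> is the right factor already suffices.
\<close>
lemma oml_centerI:
  assumes "\<And>b. foulis_prod b c = inf b c"
  shows "c \<in> oml_center"
proof -
  have "foulis_prod c b = inf c b" for b
  proof (rule foulis_prod_eq_inf_if_split)
    show "c = sup (inf c b) (inf c (- b))"
      using split_if_foulis_prod_eq_inf[OF assms[of b]] by (simp add: ac_simps)
  qed
  then show ?thesis
    using assms by (simp add: oml_center_def ac_simps)
qed

lemma central_splits:
  assumes "c \<in> oml_center"
  shows "b = sup (inf b c) (inf b (- c))"
proof -
  have "foulis_prod c b = inf c b"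
    using assms by (simp add: oml_center_def)
  from split_if_foulis_prod_eq_inf[OF this] show ?thesis
    by (simp add: ac_simps)
qed

lemma splits_central:
  assumes "c \<in> oml_center"
  shows "c = sup (inf b c) (inf (- b) c)"
proof (rule split_if_foulis_prod_eq_inf)
  show "foulis_prod b c = inf b c"
    using assms by (simp add: oml_center_def ac_simps)
qed

section \<open>Infinite distributivity at central elements\<close>

text \<open>
  Every member of \<open>A\<close> splits along \<open>c\<close> and hence lies below \<open>sup s (- c)\<close>, where \<open>s\<close> is the join
  on the right; cutting the resulting bound on \<open>Sup A\<close> down to \<open>c\<close> removes \<open>- c\<close> again.
\<close>
lemma Sup_inf_central:
  assumes c: "c \<in> oml_center"
  shows "inf (Sup A) c = (SUP a\<in>A. inf a c)"
proof (rule antisym)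
  define s where "s = (SUP a\<in>A. inf a c)"
  have "Sup A \<le> sup s (- c)"
  proof (rule Sup_least)
    fix a assume "a \<in> A"
    then have "inf a c \<le> s" unfolding s_def by (rule SUP_upper)
    then have "sup (inf a c) (inf a (- c)) \<le> sup s (- c)"
      by (rule sup_mono) simp
    then show "a \<le> sup s (- c)"
      using central_splits[OF c] by metis
  qed
  then have "inf (Sup A) c \<le> inf (sup s (- c)) c" by (rule inf_mono) simp
  also have "\<dots> = s"
    by (rule orthomodular_cut) (simp add: s_def SUP_le_iff)
  finally show "inf (Sup A) c \<le> (SUP a\<in>A. inf a c)" unfolding s_def .
  show "(SUP a\<in>A. inf a c) \<le> inf (Sup A) c"
    by (rule SUP_least) (simp add: Sup_upper le_infI1)
qed

text \<open>The same residuation with the roles exchanged: here the members of \<open>C\<close> split along \<open>a\<close>.\<close>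
lemma inf_Sup_central:
  assumes C: "C \<subseteq> oml_center"
  shows "inf a (Sup C) = (SUP c\<in>C. inf a c)"
proof (rule antisym)
  define s where "s = (SUP c\<in>C. inf a c)"
  have "Sup C \<le> sup s (- a)"
  proof (rule Sup_least)
    fix c assume "c \<in> C"
    then have "inf a c \<le> s" unfolding s_def by (rule SUP_upper)
    then have "sup (inf a c) (inf (- a) c) \<le> sup s (- a)"
      by (rule sup_mono) simp
    then show "c \<le> sup s (- a)"
      using splits_central C \<open>c \<in> C\<close> by (metis subsetD)
  qed
  then have "inf a (Sup C) \<le> inf (sup s (- a)) a"
    by (simp add: le_infI2)
  also have "\<dots> = s"
    by (rule orthomodular_cut) (simp add: s_def SUP_le_iff)
  finally show "inf a (Sup C) \<le> (SUP c\<in>C. inf a c)" unfolding s_def .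
  show "(SUP c\<in>C. inf a c) \<le> inf a (Sup C)"
    by (rule SUP_least) (simp add: Sup_upper le_infI2)
qed

lemma inf_sup_central:
  assumes "y \<in> oml_center" "z \<in> oml_center"
  shows "inf x (sup y z) = sup (inf x y) (inf x z)"
  using inf_Sup_central[of "{y, z}" x] assms by simp

text \<open>
  By De Morgan and \<open>inf_sup_central\<close>, closure under complements makes both finite distributive
  laws automatic for a set of central elements.
\<close>
lemma complete_boolean_subalgebraI:
  assumes central: "M \<subseteq> oml_center"
    and Sup: "\<And>A. A \<subseteq> M \<Longrightarrow> Sup A \<in> M"
    and Inf: "\<And>A. A \<subseteq> M \<Longrightarrow> Inf A \<in> M"
    and compl: "\<And>x. x \<in> M \<Longrightarrow> - x \<in> M"
  shows "complete_boolean_subalgebra M"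
proof -
  have dist: "inf x (sup y z) = sup (inf x y) (inf x z)" if "y \<in> M" "z \<in> M" for x y z
    using that central by (intro inf_sup_central) auto
  have "sup x (inf y z) = inf (sup x y) (sup x z)" if "y \<in> M" "z \<in> M" for x y z
  proof -
    have "- sup x (inf y z) = - inf (sup x y) (sup x z)"
      using dist[of "- y" "- z" "- x"] that compl by simp
    then show ?thesis by (simp only: compl_eq_compl_iff)
  qed
  with assms dist show ?thesis
    unfolding complete_boolean_subalgebra_def by simp
qed

section \<open>From subalgebras to endomorphisms\<close>

definition least_above :: "'a::complete_lattice set \<Rightarrow> 'a \<Rightarrow> 'a"
  where "least_above M a = Inf {m \<in> M. a \<le> m}"

lemma le_least_above: "a \<le> least_above M a"
  unfolding least_above_def by (rule Inf_greatest) simp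

lemma least_above_le: "m \<in> M \<Longrightarrow> a \<le> m \<Longrightarrow> least_above M a \<le> m"
  unfolding least_above_def by (rule Inf_lower) simp

lemma least_above_in:
  "(\<And>A. A \<subseteq> M \<Longrightarrow> Inf A \<in> M) \<Longrightarrow> least_above M a \<in> M"
  unfolding least_above_def by simp

lemma fixed_points_least_above:
  assumes "\<And>A. A \<subseteq> M \<Longrightarrow> Inf A \<in> M"
  shows "{a. least_above M a = a} = M"
  using least_above_in[OF assms] least_above_le[of _ M] le_least_above[of _ M]
  by (auto intro: antisym) metis

lemma least_above_closure_operation:
  assumes "\<And>A. A \<subseteq> M \<Longrightarrow> Inf A \<in> M"
  shows "closure_operation (least_above M)"
  unfolding closure_operation_def
proof (intro conjI allI monoI)
  fix a b :: 'a
  have "least_above M x \<in> M" for x by (rule least_above_in[OF assms])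
  then show "least_above M (least_above M a) = least_above M a"
    by (intro antisym least_above_le le_least_above) simp_all
  show "least_above M a \<le> least_above M b" if "a \<le> b"
    using \<open>least_above M b \<in> M\<close> that le_least_above[of b M]
    by (intro least_above_le) (auto intro: order_trans)
qed (rule le_least_above)

theorem least_above_borceux_van_den_bossche:
  assumes M: "complete_boolean_subalgebra M" and central: "M \<subseteq> oml_center"
  shows "borceux_van_den_bossche (least_above M)"
proof -
  let ?j = "least_above M"
  have Sup_in: "Sup A \<in> M" and Inf_in: "Inf A \<in> M" if "A \<subseteq> M" for A
    using M that by (simp_all add: complete_boolean_subalgebra_def)
  have compl_in: "- x \<in> M" if "x \<in> M" for x
    using M that by (simp add: complete_boolean_subalgebra_def)
  have inf_in: "inf x y \<in> M" and sup_in: "sup x y \<in> M" if "x \<in> M" "y \<in> M" for x y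
    using Inf_in[of "{x, y}"] Sup_in[of "{x, y}"] that by simp_all
  have j_in: "?j a \<in> M" for a by (rule least_above_in[OF Inf_in])
  have cut: "inf (sup x (- c)) c = inf x c" if "c \<in> M" for x c
    using that central by (auto simp: oml_center_def foulis_prod_def inf_commute)

  have cond2: "?j (inf a (?j b)) = inf (?j a) (?j b)" for a b
  proof (rule antisym)
    show "?j (inf a (?j b)) \<le> inf (?j a) (?j b)"
      by (intro least_above_le inf_in j_in inf_mono le_least_above order_refl)
    define k where "k = ?j (inf a (?j b))"
    \<comment> \<open>\<open>sup k (- ?j b)\<close> is the residual of \<open>k\<close> by \<open>?j b\<close>, and it belongs to \<open>M\<close>.\<close>
    have "inf a (?j b) \<le> k" unfolding k_def by (rule le_least_above)
    then have "sup (inf a (?j b)) (inf a (- ?j b)) \<le> sup k (- ?j b)"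
      by (rule sup_mono) simp
    then have "a \<le> sup k (- ?j b)"
      using central_splits[of "?j b" a] j_in central by (metis subsetD)
    then have "?j a \<le> sup k (- ?j b)"
      by (intro least_above_le sup_in compl_in j_in) (simp_all add: k_def j_in)
    then have "inf (?j a) (?j b) \<le> inf (sup k (- ?j b)) (?j b)"
      by (rule inf_mono) simp
    also have "\<dots> \<le> k" by (simp add: cut j_in)
    finally show "inf (?j a) (?j b) \<le> ?j (inf a (?j b))" unfolding k_def .
  qed

  have j_Sup: "?j (Sup B) = Sup (?j ` B)" for B
  proof (rule antisym)
    have "Sup B \<le> Sup (?j ` B)"
      by (rule Sup_least) (meson SUP_upper2 le_least_above)
    then show "?j (Sup B) \<le> Sup (?j ` B)"
      by (intro least_above_le Sup_in) (auto simp: j_in)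
    show "Sup (?j ` B) \<le> ?j (Sup B)"
      by (intro SUP_least least_above_le j_in order_trans[OF Sup_upper le_least_above])
  qed
  have cond3: "inf a (?j (Sup B)) = (SUP b\<in>B. inf a (?j b))" for a B
  proof -
    have "?j ` B \<subseteq> oml_center" using j_in central by auto
    from inf_Sup_central[OF this, of a] show ?thesis
      by (simp add: j_Sup image_image)
  qed
  have cond4: "inf (Sup A) (?j b) = (SUP a\<in>A. inf a (?j b))" for A b
    using j_in central by (intro Sup_inf_central) auto
  show ?thesis
    unfolding borceux_van_den_bossche_def
    using least_above_closure_operation[OF Inf_in] le_least_above cond2 cond3 cond4 by blast
qed

section \<open>From endomorphisms to subalgebras\<close>

text \<open>
  For a fixed point \<open>m\<close> the fourth condition says that \<open>\<lambda>x. inf x m\<close> preserves joins; on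
  \<open>sup b (- m)\<close> this gives \<open>sup (inf b m) (inf (- m) m)\<close>, whose second part vanishes.
\<close>
lemma fixed_point_central:
  assumes "borceux_van_den_bossche j" and "j m = m"
  shows "m \<in> oml_center"
proof (rule oml_centerI)
  fix b
  have "inf (Sup {b, - m}) (j m) = (SUP a\<in>{b, - m}. inf a (j m))"
    using assms(1) unfolding borceux_van_den_bossche_def by blast
  then show "foulis_prod b m = inf b m"
    by (simp add: assms(2) foulis_prod_def)
qed

text \<open>
  The empty instance of the third condition gives \<open>j bot = bot\<close>, so the second condition turns
  the disjointness of \<open>- m\<close> and \<open>m\<close> into that of \<open>j (- m)\<close> and \<open>m\<close>.
\<close>
lemma fixed_point_compl:
  assumes j: "borceux_van_den_bossche j" and m: "j m = m"
  shows "j (- m) = - m"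
proof (rule antisym)
  have "inf top (j (Sup {})) = (SUP b\<in>{}. inf top (j b))"
    using j unfolding borceux_van_den_bossche_def by blast
  then have bot: "j bot = bot" by simp
  have "j (inf (- m) (j m)) = inf (j (- m)) (j m)"
    using j unfolding borceux_van_den_bossche_def by blast
  then have "inf (j (- m)) m = bot" by (simp add: m bot)
  then have "j (- m) = inf (j (- m)) (- m)"
    using central_splits[OF fixed_point_central[OF j m], of "j (- m)"] by simp
  then show "j (- m) \<le> - m" by (metis inf_le2)
  show "- m \<le> j (- m)"
    using j by (simp add: borceux_van_den_bossche_def)
qed

theorem fixed_points_complete_boolean_subalgebra:
  assumes j: "borceux_van_den_bossche j"
  shows "complete_boolean_subalgebra {a. j a = a}"
proof (rule complete_boolean_subalgebraI)
  have mono: "mono j" and le_j: "\<And>a. a \<le> j a"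
    using j by (simp_all add: borceux_van_den_bossche_def closure_operation_def)
  show "{a. j a = a} \<subseteq> oml_center"
    using fixed_point_central[OF j] by auto
  show "- x \<in> {a. j a = a}" if "x \<in> {a. j a = a}" for x
    using that fixed_point_compl[OF j] by simp
  fix A assume "A \<subseteq> {a. j a = a}"
  then have fixed: "j a = a" if "a \<in> A" for a using that by auto
  have "inf top (j (Sup A)) = (SUP a\<in>A. inf top (j a))"
    using j unfolding borceux_van_den_bossche_def by blast
  then show "Sup A \<in> {a. j a = a}" by (simp add: fixed)
  have "j (Inf A) \<le> a" if "a \<in> A" for a
    using monoD[OF mono Inf_lower[OF that]] fixed[OF that] by simp
  then have "j (Inf A) \<le> Inf A" by (rule Inf_greatest)
  then show "Inf A \<in> {a. j a = a}" by (simp add: antisym le_j)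
qed

lemma least_above_fixed_points:
  assumes "closure_operation j"
  shows "least_above {a. j a = a} = j"
proof (rule ext, rule antisym)
  fix a
  have j: "mono j" "a \<le> j a" "j (j a) = j a"
    using assms by (simp_all add: closure_operation_def)
  then show "least_above {a. j a = a} a \<le> j a" by (intro least_above_le) simp_all
  show "j a \<le> least_above {a. j a = a} a"
    unfolding least_above_def
  proof (rule Inf_greatest)
    fix m assume "m \<in> {m \<in> {a. j a = a}. a \<le> m}"
    then show "j a \<le> m" using monoD[OF j(1), of a m] by simp
  qed
qed

section \<open>The correspondence\<close>

theorem theorem1:
  shows "\<exists>\<Phi> :: 'a::complete_orthomodular_lattice set \<Rightarrow> ('a \<Rightarrow> 'a).
    bij_betw \<Phi> {M. complete_boolean_subalgebra M \<and> M \<subseteq> oml_center}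
               {j. borceux_van_den_bossche j} \<and>
    (\<forall>M. complete_boolean_subalgebra M \<and> M \<subseteq> oml_center \<longrightarrow>
       (\<forall>a. \<Phi> M a = Inf {m \<in> M. a \<le> m}) \<and>
       M = {a. \<Phi> M a = a})"
proof (intro exI[of _ least_above] conjI allI impI)
  have fixed: "{a. least_above M a = a} = M" if "complete_boolean_subalgebra M" for M :: "'a set"
    using that by (intro fixed_points_least_above) (simp add: complete_boolean_subalgebra_def)
  show "bij_betw least_above {M :: 'a set. complete_boolean_subalgebra M \<and> M \<subseteq> oml_center}
          {j. borceux_van_den_bossche j}"
  proof (rule bij_betw_byWitness[where f' = "\<lambda>j. {a. j a = a}"])
    show "\<forall>j\<in>{j. borceux_van_den_bossche j}. least_above {a :: 'a. j a = a} = j"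
      using least_above_fixed_points by (auto simp: borceux_van_den_bossche_def)
    show "(\<lambda>j. {a :: 'a. j a = a}) ` {j. borceux_van_den_bossche j}
        \<subseteq> {M. complete_boolean_subalgebra M \<and> M \<subseteq> oml_center}"
      using fixed_points_complete_boolean_subalgebra fixed_point_central by blast
  qed (auto simp: fixed least_above_borceux_van_den_bossche)
  fix M :: "'a set"
  assume "complete_boolean_subalgebra M \<and> M \<subseteq> oml_center"
  then show "M = {a. least_above M a = a}" using fixed by simp
qed (rule least_above_def)

end
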